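(* Let $f:\operatorname{dom}(f)\subseteq\mathbb{R}^n\to\mathbb{R}$ and $g:\operatorname{dom}(g)\subseteq\mathbb{R}^n\to\mathbb{R}$ be $\mathcal{C}^3$ on the open ball $B(x^0,\overline{\Delta})$, and denote by $L_f$ and $L_g$ the Lipschitz constants of $\nabla^2 f$ and $\nabla^2 g$ on this ball. Let $\mathcal{X}=\langle x^0,x^1,\ldots,x^m\rangle$ be an ordered set of distinct points with radius $\Delta<\overline{\Delta}$ such that $S=S(\mathcal{X})$ has full rank. Let $\mathbb{U}=\operatorname{span}S$ and $\widehat{S}=S/\Delta$. Then $$\|\nabla^{cc}(fg)(\mathcal{X})-\nabla(fg)_{\mathbb{U}}(x^0)\|\le\frac{\sqrt{m}}{6}\big(L_g|f(x^0)|+L_f|g(x^0)|\big)\big\|(\widehat{S}^\top)^\dagger\big\|\Delta^2.$$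
   Context: Vectors carry the Euclidean norm and matrices the induced operator norm; $A^\dagger$ is the Moore--Penrose pseudoinverse. For $\mathcal{X}=\langle x^0,x^1,\ldots,x^m\rangle\subset\mathbb{R}^n$ write $x^i=x^0+d^i$ ($m\ge1$); the radius is $\Delta=\max_i\|d^i\|$ and $S(\mathcal{X})=[d^1\ \cdots\ d^m]\in\mathbb{R}^{n\times m}$. Full rank means $\operatorname{rank}S=\min\{m,n\}$; $\operatorname{span}S$ is the column span. The generalized centred simplex gradient of $h$ over $\mathcal{X}$ is $\nabla^c h(\mathcal{X})=(S^\top)^\dagger\delta^c_h(\mathcal{X})$, where $\delta^c_h(\mathcal{X})\in\mathbb{R}^m$ has $i$-th entry $\tfrac12\big(h(x^0+d^i)-h(x^0-d^i)\big)$. The generalized centred simplex calculus gradient of $fg$ over $\mathcal{X}$ is defined as $\nabla^{cc}(fg)(\mathcal{X})=f(x^0)\nabla^c g(\mathcal{X})+g(x^0)\nabla^c f(\mathcal{X})$. For a function $h$, $h_{\mathbb{U}}(y)=h\big(x^0+\operatorname{Proj}_{\mathbb{U}}(y-x^0)\big)$ with $\operatorname{Proj}_{\mathbb{U}}$ the orthogonal projection onto $\mathbb{U}$. The Lipschitz constants are assumed finite: $\|\nabla^2 f(x)-\nabla^2 f(y)\|\le L_f\|x-y\|$ on $B(x^0,\overline{\Delta})$, and similarly for $g$. *)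

theory Defs
  imports "HOL-Analysis.Analysis"
begin

text \<open>The gradient as a vector; it is only meaningful where a vector \<open>D\<close> with
  \<open>GDERIV f x :> D\<close> exists, in which case it is unique.\<close>

definition gradient :: "('a::real_inner \<Rightarrow> real) \<Rightarrow> 'a \<Rightarrow> 'a" where
  "gradient f x = (THE D. GDERIV f x :> D)"

definition hessian :: "(real^'n \<Rightarrow> real) \<Rightarrow> real^'n \<Rightarrow> real^'n^'n" where
  "hessian f x = jacobian (gradient f) (at x)"

text \<open>\<open>Ck_on k f A\<close>: \<open>f\<close> is of class \<open>C\<^sup>k\<close> on the set \<open>A\<close>, which is meant to be open.\<close>

fun Ck_on :: "nat \<Rightarrow> ('a::real_normed_vector \<Rightarrow> 'b::real_normed_vector) \<Rightarrow> 'a set \<Rightarrow> bool" where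
  "Ck_on 0 f A \<longleftrightarrow> continuous_on A f"
| "Ck_on (Suc k) f A \<longleftrightarrow> (\<forall>x\<in>A. f differentiable (at x)) \<and>
     (\<forall>v. Ck_on k (\<lambda>x. frechet_derivative f (at x) v) A)"

text \<open>The norm of a matrix induced by the Euclidean norms. The type-class norm on
  \<open>real^'n^'m\<close> is the Frobenius norm and therefore not used for matrices.\<close>

definition op_norm :: "real^'n^'m \<Rightarrow> real" where
  "op_norm A = onorm ((*v) A)"

definition is_pseudoinverse :: "real^'n^'m \<Rightarrow> real^'m^'n \<Rightarrow> bool" where
  "is_pseudoinverse A B \<longleftrightarrow>
     A ** B ** A = A \<and> B ** A ** B = B \<and>
     transpose (A ** B) = A ** B \<and> transpose (B ** A) = B ** A"

definition pseudoinverse :: "real^'n^'m \<Rightarrow> real^'m^'n" where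
  "pseudoinverse A = (THE B. is_pseudoinverse A B)"

definition orth_projection :: "'a::euclidean_space set \<Rightarrow> 'a \<Rightarrow> 'a" where
  "orth_projection U y = (THE p. p \<in> U \<and> (\<forall>u\<in>U. orthogonal (y - p) u))"

text \<open>An ordered set of points \<open>x\<^sup>0, x\<^sup>1, \<dots>, x\<^sup>m\<close> is given by the reference point
  \<open>x0\<close> and a family \<open>x\<close> indexed by a finite type \<open>'m\<close>, so that
  \<open>m = CARD('m) \<ge> 1\<close>. The directions are \<open>d\<^sup>i = x i - x0\<close>.\<close>

definition radius :: "real^'n \<Rightarrow> ('m::finite \<Rightarrow> real^'n) \<Rightarrow> real" where
  "radius x0 x = Max (range (\<lambda>i. norm (x i - x0)))"

text \<open>The directions are the columns.\<close>

definition simplex_matrix :: "real^'n \<Rightarrow> ('m::finite \<Rightarrow> real^'n) \<Rightarrow> real^'m^'n" where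
  "simplex_matrix x0 x = (\<chi> r i. (x i - x0) $ r)"

definition centred_difference ::
    "(real^'n \<Rightarrow> real) \<Rightarrow> real^'n \<Rightarrow> ('m::finite \<Rightarrow> real^'n) \<Rightarrow> real^'m" where
  "centred_difference h x0 x =
     (\<chi> i. (h (x0 + (x i - x0)) - h (x0 - (x i - x0))) / 2)"

definition centred_simplex_gradient ::
    "(real^'n \<Rightarrow> real) \<Rightarrow> real^'n \<Rightarrow> ('m::finite \<Rightarrow> real^'n) \<Rightarrow> real^'n" where
  "centred_simplex_gradient h x0 x =
     pseudoinverse (transpose (simplex_matrix x0 x)) *v centred_difference h x0 x"

definition centred_simplex_calculus_gradient ::
    "(real^'n \<Rightarrow> real) \<Rightarrow> (real^'n \<Rightarrow> real) \<Rightarrow> real^'n \<Rightarrow> ('m::finite \<Rightarrow> real^'n) \<Rightarrow> real^'n" where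
  "centred_simplex_calculus_gradient f g x0 x =
     f x0 *\<^sub>R centred_simplex_gradient g x0 x + g x0 *\<^sub>R centred_simplex_gradient f x0 x"

text \<open>The function \<open>h\<^sub>U\<close>, relative to the base point \<open>x0\<close>.\<close>

definition restrict_to_subspace ::
    "'a::euclidean_space set \<Rightarrow> 'a \<Rightarrow> ('a \<Rightarrow> real) \<Rightarrow> 'a \<Rightarrow> real" where
  "restrict_to_subspace U x0 h y = h (x0 + orth_projection U (y - x0))"

end

theory Submission
  imports Defs
begin

text \<open>
  Write \<open>B = (S\<^sup>T)\<^sup>\<dagger>\<close> and let \<open>h\<close> be one of the two factors. The centred simplex gradient of
  \<open>h\<close> is \<open>B\<close> applied to the vector of centred differences, and the centred difference in
  direction \<open>d\<^sup>i\<close> approximates \<open>d\<^sup>i \<bullet> \<nabla>h(x\<^sup>0)\<close>, the \<open>i\<close>-th entry of \<open>S\<^sup>T \<nabla>h(x\<^sup>0)\<close>. Two facts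
  therefore control everything.

  First, the matrix \<open>B S\<^sup>T\<close> is the orthogonal projection onto the column span \<open>U\<close> of \<open>S\<close>
  (\<open>pseudoinverse_transpose_mult_eq_orth_projection\<close>), so that exact differences would produce
  exactly the projection of \<open>\<nabla>h(x\<^sup>0)\<close>. Since projections are self-adjoint, the gradient of a
  function that is composed with the projection onto \<open>U\<close> is the projected gradient
  (\<open>gradient_restrict_to_subspace\<close>), and so by the product rule the target
  \<open>\<nabla>(fg)\<^sub>U(x\<^sup>0)\<close> is the combination of the two projected gradients with the same weights
  \<open>f(x\<^sup>0)\<close> and \<open>g(x\<^sup>0)\<close> as in the calculus gradient. The error is thus at most the weighted sum of
  the errors for \<open>g\<close> and for \<open>f\<close> alone.

  Second, a centred difference is odd in the direction, so the second-order terms cancel and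
  a Hessian with Lipschitz constant \<open>L\<close> gives an error of at most \<open>L \<parallel>d\<^sup>i\<parallel>\<^sup>3 / 6\<close>
  (\<open>centred_difference_error\<close>). Each of the \<open>m\<close> entries of the error vector is bounded by
  \<open>L \<Delta>\<^sup>3 / 6\<close>, hence its Euclidean norm by \<open>sqrt m\<close> times this, and applying \<open>B\<close> costs the
  factor \<open>\<parallel>B\<parallel>\<close> (\<open>simplex_gradient_error\<close>). One of the three powers of \<open>\<Delta>\<close> is absorbed by passing
  from \<open>S\<close> to \<open>S / \<Delta>\<close>, because the pseudoinverse is homogeneous of degree \<open>-1\<close>.
\<close>

section \<open>Orthogonal projections\<close>

text \<open>
  If \<open>p\<close> and \<open>q\<close> both qualify, then \<open>q - p\<close> is a vector of \<open>U\<close>, hence orthogonal to both residuals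
  and so to their difference, which is \<open>q - p\<close> again. Besides making the definite description
  meaningful, this rule is the means of computing projections.
\<close>

lemma orth_projection_unique:
  fixes U :: "'a::euclidean_space set"
  assumes U: "subspace U" and p: "p \<in> U" "\<And>u. u \<in> U \<Longrightarrow> orthogonal (y - p) u"
  shows "orth_projection U y = p"
  unfolding orth_projection_def
proof (rule the_equality)
  show "p \<in> U \<and> (\<forall>u\<in>U. orthogonal (y - p) u)"
    using p by blast
next
  fix q assume q: "q \<in> U \<and> (\<forall>u\<in>U. orthogonal (y - q) u)"
  have "q - p \<in> U"
    using U p(1) q by (simp add: subspace_diff)
  then have "(y - p) \<bullet> (q - p) = 0" "(y - q) \<bullet> (q - p) = 0"
    using p(2) q by (auto simp: orthogonal_def)
  then have "(q - p) \<bullet> (q - p) = 0"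
    by (simp add: inner_diff_left)
  then show "q = p"
    by simp
qed

lemma orth_projection_characterization:
  fixes U :: "'a::euclidean_space set"
  assumes U: "subspace U"
  shows "orth_projection U y \<in> U" and "u \<in> U \<Longrightarrow> orthogonal (y - orth_projection U y) u"
proof -
  obtain p z where p: "p \<in> span U" "\<And>w. w \<in> span U \<Longrightarrow> orthogonal z w" "y = p + z"
    using orthogonal_subspace_decomp_exists by blast
  have "orth_projection U y = p"
  proof (rule orth_projection_unique [OF U])
    show "p \<in> U"
      using p(1) U by (metis span_eq_iff)
    show "orthogonal (y - p) u" if "u \<in> U" for u
      using p that by (simp add: span_base)
  qed
  then show "orth_projection U y \<in> U" "u \<in> U \<Longrightarrow> orthogonal (y - orth_projection U y) u"
    using p U by (auto simp: span_base) (metis span_eq_iff)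
qed

lemma linear_orth_projection:
  fixes U :: "'a::euclidean_space set"
  assumes U: "subspace U"
  shows "linear (orth_projection U)"
proof (rule linearI)
  fix x y :: 'a and c :: real
  note P = orth_projection_characterization [OF U]
  show "orth_projection U (x + y) = orth_projection U x + orth_projection U y"
  proof (rule orth_projection_unique [OF U])
    show "orth_projection U x + orth_projection U y \<in> U"
      using P(1) U by (simp add: subspace_add)
    show "orthogonal (x + y - (orth_projection U x + orth_projection U y)) u" if "u \<in> U" for u
      using P(2) [OF that, of x] P(2) [OF that, of y]
      by (simp add: orthogonal_def inner_diff_left inner_add_left)
  qed
  show "orth_projection U (c *\<^sub>R x) = c *\<^sub>R orth_projection U x"
  proof (rule orth_projection_unique [OF U])
    show "c *\<^sub>R orth_projection U x \<in> U"
      using P(1) U by (simp add: subspace_scale)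
    show "orthogonal (c *\<^sub>R x - c *\<^sub>R orth_projection U x) u" if "u \<in> U" for u
      using P(2) [OF that, of x]
      by (simp add: orthogonal_def inner_diff_left)
  qed
qed

lemma orth_projection_self_adjoint:
  fixes U :: "'a::euclidean_space set"
  assumes U: "subspace U"
  shows "orth_projection U y \<bullet> z = y \<bullet> orth_projection U z"
proof -
  note P = orth_projection_characterization [OF U]
  have "(z - orth_projection U z) \<bullet> orth_projection U y = 0"
    "(y - orth_projection U y) \<bullet> orth_projection U z = 0"
    using P by (simp_all add: orthogonal_def)
  then show ?thesis
    by (simp add: inner_diff_left inner_commute [of z] inner_commute [of "orth_projection U z"])
qed

section \<open>The pseudoinverse\<close>

\<comment> \<open>As a rewrite rule this turns every \<open>transpose A *v v\<close> into \<open>v v* A\<close>, which hides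
  that the transpose is itself a matrix with a column span and a pseudoinverse.\<close>
declare transpose_matrix_vector [simp del]

lemma matrix_adjoint_inner:
  fixes A :: "real^'n^'m"
  shows "(A *v v) \<bullet> w = v \<bullet> (transpose A *v w)"
  by (metis adjoint_matrix adjoint_works inner_commute matrix_vector_mul_linear)

lemma transpose_eq_self_iff_self_adjoint:
  fixes A :: "real^'n^'n"
  shows "transpose A = A \<longleftrightarrow> (\<forall>v w. (A *v v) \<bullet> w = v \<bullet> (A *v w))"
proof
  assume "transpose A = A"
  then show "\<forall>v w. (A *v v) \<bullet> w = v \<bullet> (A *v w)"
    by (metis matrix_adjoint_inner)
next
  assume A: "\<forall>v w. (A *v v) \<bullet> w = v \<bullet> (A *v w)"
  have "v \<bullet> (transpose A *v w) = v \<bullet> (A *v w)" for v w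
    using A by (metis matrix_adjoint_inner)
  then have "transpose A *v w = A *v w" for w
    by (metis vector_eq_ldot)
  then show "transpose A = A"
    by (simp add: matrix_eq)
qed

text \<open>
  Penrose's argument. From \<open>A B = (A C) (A B)\<close> and the symmetry of both factors, transposing gives
  \<open>A B = (A B) (A C) = A C\<close>, and likewise \<open>B A = C A\<close>; then \<open>B = B A B = C A C = C\<close>.
\<close>

lemma is_pseudoinverse_unique:
  fixes A :: "real^'n^'m"
  assumes B: "is_pseudoinverse A B" and C: "is_pseudoinverse A C"
  shows "B = C"
proof -
  have AB: "A ** B = A ** C"
  proof -
    have "A ** B = transpose (A ** C ** (A ** B))"
      using B C unfolding is_pseudoinverse_def by (simp add: matrix_mul_assoc)
    also have "\<dots> = A ** B ** (A ** C)"
      using B C unfolding is_pseudoinverse_def by (simp add: matrix_transpose_mul)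
    also have "\<dots> = A ** C"
      using B unfolding is_pseudoinverse_def by (simp add: matrix_mul_assoc)
    finally show ?thesis .
  qed
  have BA: "B ** A = C ** A"
  proof -
    have "B ** A = transpose (B ** A ** (C ** A))"
      using B C unfolding is_pseudoinverse_def
      by (metis matrix_mul_assoc)
    also have "\<dots> = C ** A ** (B ** A)"
      using B C unfolding is_pseudoinverse_def by (simp add: matrix_transpose_mul)
    also have "\<dots> = C ** A"
      using B unfolding is_pseudoinverse_def by (metis matrix_mul_assoc)
    finally show ?thesis .
  qed
  have "B = B ** A ** B"
    using B unfolding is_pseudoinverse_def by simp
  also have "\<dots> = C ** A ** C"
    using AB BA by (metis matrix_mul_assoc)
  also have "\<dots> = C"
    using C unfolding is_pseudoinverse_def by simp
  finally show ?thesis .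
qed

text \<open>
  The map \<open>A\<close> ignores the component orthogonal to the row space \<open>R\<close> and is injective on \<open>R\<close>. The
  pseudoinverse inverts this restriction after projecting onto the range \<open>Q\<close> of \<open>A\<close>. Then
  \<open>A B\<close> and \<open>B A\<close> are the orthogonal projections onto \<open>Q\<close> and \<open>R\<close>, from which all four
  Penrose equations can be read off.
\<close>

lemma is_pseudoinverse_exists:
  fixes A :: "real^'n^'m"
  shows "\<exists>B. is_pseudoinverse A B"
proof -
  define R where "R = range ((*v) (transpose A))"
  define Q where "Q = range ((*v) A)"
  have R: "subspace R" and Q: "subspace Q"
    by (auto simp: R_def Q_def intro!: linear_subspace_image)
  note PR = orth_projection_characterization [OF R]
  note PQ = orth_projection_characterization [OF Q]
  have A_PR: "A *v orth_projection R v = A *v v" for v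
  proof -
    have "(A *v (v - orth_projection R v)) \<bullet> w = 0" for w
      using PR(2) [of "transpose A *v w" v] by (simp add: R_def orthogonal_def matrix_adjoint_inner)
    then show ?thesis
      by (metis eq_iff_diff_eq_0 inner_eq_zero_iff matrix_vector_mult_diff_distrib)
  qed
  have PQ_A: "orth_projection Q (A *v v) = A *v v" for v
    by (rule orth_projection_unique [OF Q]) (auto simp: Q_def orthogonal_def)
  have "inj_on ((*v) A) R"
  proof (rule inj_onI)
    fix v w assume vw: "v \<in> R" "w \<in> R" "A *v v = A *v w"
    then have "v - w \<in> R"
      using R by (simp add: subspace_diff)
    then obtain z where z: "v - w = transpose A *v z"
      by (auto simp: R_def)
    have "(v - w) \<bullet> (v - w) = (A *v (v - w)) \<bullet> z"
      by (subst (2) z) (simp add: matrix_adjoint_inner)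
    then show "v = w"
      using vw by (simp add: matrix_vector_mult_diff_distrib)
  qed
  then obtain h where h: "range h \<subseteq> R" "linear h" "\<And>v. v \<in> R \<Longrightarrow> h (A *v v) = v"
    using linear_exists_left_inverse_on [OF matrix_vector_mul_linear R, of A] by auto
  define B where "B = matrix (h \<circ> orth_projection Q)"
  have B: "B *v y = h (orth_projection Q y)" for y
    unfolding B_def
    by (simp add: matrix_works linear_matrix_vector_mul_eq linear_compose linear_orth_projection Q h(2))
  have BA: "B *v (A *v v) = orth_projection R v" for v
    using h(3) [OF PR(1)] by (simp add: B PQ_A A_PR)
  have AB: "A *v (B *v y) = orth_projection Q y" for y
  proof -
    obtain z where z: "orth_projection Q y = A *v z"
      using PQ(1) by (auto simp: Q_def)
    then have "B *v y = orth_projection R z"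
      using BA [of z] by (simp add: B PQ_A)
    then show ?thesis
      using z A_PR by simp
  qed
  have PR_B: "orth_projection R (B *v y) = B *v y" for y
    by (rule orth_projection_unique [OF R]) (use h(1) B in \<open>auto simp: orthogonal_def\<close>)
  have "is_pseudoinverse A B"
    unfolding is_pseudoinverse_def
  proof (intro conjI)
    show "A ** B ** A = A"
      by (simp add: matrix_eq AB PQ_A flip: matrix_vector_mul_assoc)
    show "B ** A ** B = B"
      by (simp add: matrix_eq BA PR_B flip: matrix_vector_mul_assoc)
    show "transpose (A ** B) = A ** B" "transpose (B ** A) = B ** A"
      unfolding transpose_eq_self_iff_self_adjoint
      by (simp_all add: AB BA orth_projection_self_adjoint Q R flip: matrix_vector_mul_assoc)
  qed
  then show ?thesis ..
qed

lemma pseudoinverse_eqI: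
  fixes A :: "real^'n^'m"
  assumes "is_pseudoinverse A B"
  shows "pseudoinverse A = B"
  unfolding pseudoinverse_def using assms is_pseudoinverse_unique by blast

lemma is_pseudoinverse_pseudoinverse:
  fixes A :: "real^'n^'m"
  shows "is_pseudoinverse A (pseudoinverse A)"
  using is_pseudoinverse_exists pseudoinverse_eqI by metis

lemma pseudoinverse_scaleR:
  fixes A :: "real^'n^'m"
  assumes "c \<noteq> 0"
  shows "pseudoinverse (c *\<^sub>R A) = inverse c *\<^sub>R pseudoinverse A"
proof (rule pseudoinverse_eqI)
  show "is_pseudoinverse (c *\<^sub>R A) (inverse c *\<^sub>R pseudoinverse A)"
    using is_pseudoinverse_pseudoinverse [of A] assms
    unfolding is_pseudoinverse_def
    by (simp add: matrix_scalar_ac transpose_scalar flip: scalar_matrix_assoc)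
qed

text \<open>
  The product \<open>B S\<^sup>T\<close> is symmetric, hence equal to \<open>S B\<^sup>T\<close>, and so its values lie in the column
  span of \<open>S\<close>; and \<open>S\<^sup>T B S\<^sup>T = S\<^sup>T\<close> says that the residual \<open>v - B S\<^sup>T v\<close> is orthogonal to every
  column of \<open>S\<close>.
\<close>

lemma pseudoinverse_transpose_mult_eq_orth_projection:
  fixes S :: "real^'m^'n"
  shows "pseudoinverse (transpose S) *v (transpose S *v v) = orth_projection (span (columns S)) v"
proof -
  let ?A = "transpose S"
  let ?B = "pseudoinverse ?A"
  have ABA: "?A ** ?B ** ?A = ?A" and BA: "transpose (?B ** ?A) = ?B ** ?A"
    using is_pseudoinverse_pseudoinverse [of ?A] by (auto simp: is_pseudoinverse_def)
  have "orth_projection (span (columns S)) v = ?B *v (?A *v v)"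
  proof (rule orth_projection_unique [OF subspace_span])
    have "?B *v (?A *v v) = S *v (transpose ?B *v v)"
      using BA by (metis matrix_transpose_mul matrix_vector_mul_assoc transpose_transpose)
    then show "?B *v (?A *v v) \<in> span (columns S)"
      by (simp add: matrix_vector_mult_in_columnspace)
  next
    fix u assume u: "u \<in> span (columns S)"
    have "?A *v (v - ?B *v (?A *v v)) = 0"
      using ABA by (simp add: matrix_vector_mult_diff_distrib matrix_vector_mul_assoc matrix_mul_assoc)
    then have "(v - ?B *v (?A *v v)) \<bullet> column i S = 0" for i
      by (metis inner_zero_left matrix_adjoint_inner matrix_vector_mult_basis transpose_transpose)
    then have "orthogonal (v - ?B *v (?A *v v)) c" if "c \<in> columns S" for c
      using that by (auto simp: columns_def orthogonal_def)
    then show "orthogonal (v - ?B *v (?A *v v)) u"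
      using u by (meson orthogonal_to_span)
  qed
  then show ?thesis ..
qed

section \<open>The induced operator norm\<close>

lemma norm_matrix_vector_mult_le:
  fixes A :: "real^'n^'m"
  shows "norm (A *v v) \<le> op_norm A * norm v"
  unfolding op_norm_def by (rule onorm) (rule matrix_vector_mul_bounded_linear)

lemma op_norm_nonneg:
  fixes A :: "real^'n^'m"
  shows "0 \<le> op_norm A"
  unfolding op_norm_def by (rule onorm_pos_le) (rule matrix_vector_mul_bounded_linear)

lemma op_norm_scaleR:
  fixes A :: "real^'n^'m"
  shows "op_norm (c *\<^sub>R A) = \<bar>c\<bar> * op_norm A"
  unfolding op_norm_def
  using onorm_scaleR [OF matrix_vector_mul_bounded_linear, of c A]
  by (simp add: scaleR_matrix_vector_assoc)

lemma norm_vec_le_sqrt_card: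
  fixes v :: "real^'m"
  assumes "\<And>i. \<bar>v $ i\<bar> \<le> b"
  shows "norm v \<le> sqrt (real CARD('m)) * b"
proof -
  have "0 \<le> b"
    using assms abs_ge_zero order_trans by blast
  have "norm v \<le> L2_set (\<lambda>i. b) (UNIV :: 'm set)"
    unfolding norm_vec_def by (rule L2_set_mono) (use assms in auto)
  also have "\<dots> = sqrt (real CARD('m)) * b"
    using \<open>0 \<le> b\<close> by (simp add: L2_set_constant)
  finally show ?thesis .
qed

section \<open>Gradients and Hessians\<close>

lemma gradient_eqI:
  assumes "GDERIV f x :> D"
  shows "gradient f x = D"
  unfolding gradient_def
proof (rule the_equality)
  show "GDERIV f x :> D"
    by (rule assms)
next
  fix E assume "GDERIV f x :> E"
  then have "(\<lambda>v. v \<bullet> E) = (\<lambda>v. v \<bullet> D)"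
    using assms has_derivative_unique unfolding gderiv_def by blast
  then show "E = D"
    by (metis vector_eq_ldot)
qed

text \<open>
  The coordinate expression transfers regularity of the directional derivatives, which is what
  \<^const>\<open>Ck_on\<close> provides, to the gradient as a vector field.
\<close>

lemma gradient_of_differentiable:
  fixes f :: "'a::euclidean_space \<Rightarrow> real"
  assumes "f differentiable (at x)"
  shows "gradient f x = (\<Sum>b\<in>Basis. frechet_derivative f (at x) b *\<^sub>R b)"
    and "GDERIV f x :> gradient f x"
proof -
  let ?D = "\<Sum>b\<in>Basis. frechet_derivative f (at x) b *\<^sub>R b"
  have der: "(f has_derivative frechet_derivative f (at x)) (at x)"
    using assms frechet_derivative_works by blast
  then have lin: "linear (frechet_derivative f (at x))"
    by (rule has_derivative_linear)
  have "frechet_derivative f (at x) v = v \<bullet> ?D" for v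
  proof -
    have "frechet_derivative f (at x) v
        = frechet_derivative f (at x) (\<Sum>b\<in>Basis. (v \<bullet> b) *\<^sub>R b)"
      by (simp add: euclidean_representation)
    also have "\<dots> = v \<bullet> ?D"
      by (simp add: linear_sum [OF lin] linear_cmul [OF lin] inner_sum_right mult.commute)
    finally show ?thesis .
  qed
  then have "frechet_derivative f (at x) = (\<lambda>v. v \<bullet> ?D)"
    by blast
  then have *: "GDERIV f x :> ?D"
    using der unfolding gderiv_def by simp
  then show "gradient f x = ?D"
    by (rule gradient_eqI)
  then show "GDERIV f x :> gradient f x"
    using * by simp
qed

lemma GDERIV_gradient_if_Ck_on:
  fixes f :: "'a::euclidean_space \<Rightarrow> real"
  assumes "Ck_on (Suc k) f A" and "x \<in> A"
  shows "GDERIV f x :> gradient f x"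
  using assms by (intro gradient_of_differentiable(2)) simp

lemma gradient_has_derivative_hessian:
  fixes f :: "real^'n \<Rightarrow> real"
  assumes f: "Ck_on (Suc (Suc k)) f A" and A: "open A" and x: "x \<in> A"
  shows "(gradient f has_derivative (*v) (hessian f x)) (at x)"
proof -
  let ?G = "\<lambda>y. \<Sum>b\<in>Basis. frechet_derivative f (at y) b *\<^sub>R b"
  have "?G differentiable (at x)"
    using f x by (intro differentiable_sum differentiable_scaleR) auto
  then obtain G' where "(?G has_derivative G') (at x)"
    unfolding differentiable_def by blast
  \<comment> \<open>The gradient agrees with the coordinate expression only where \<open>f\<close> is differentiable, so
    the derivative is transferred on the open set \<open>A\<close>.\<close>
  then have "(gradient f has_derivative G') (at x)"
    by (rule has_derivative_transform_within_open [OF _ A x])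
       (use f in \<open>simp add: gradient_of_differentiable(1)\<close>)
  then show ?thesis
    unfolding hessian_def using jacobian_works differentiable_def by blast
qed

text \<open>
  With \<open>P\<close> the projection onto \<open>U\<close>, the chain rule gives the derivative \<open>v \<mapsto> P v \<bullet> D\<close> at \<open>x0\<close>,
  because \<open>x0\<close> is mapped to itself. Self-adjointness turns this into \<open>v \<mapsto> v \<bullet> P D\<close>.
\<close>

lemma gradient_restrict_to_subspace:
  fixes h :: "'a::euclidean_space \<Rightarrow> real"
  assumes U: "subspace U" and h: "GDERIV h x0 :> D"
  shows "gradient (restrict_to_subspace U x0 h) x0 = orth_projection U D"
proof (rule gradient_eqI)
  let ?P = "orth_projection U"
  have P: "bounded_linear ?P"
    using linear_orth_projection [OF U] linear_conv_bounded_linear by blast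
  have 0: "?P 0 = 0"
    by (rule linear_0) (rule linear_orth_projection [OF U])
  have inner: "((\<lambda>y. x0 + ?P (y - x0)) has_derivative ?P) (at x0)"
    using has_derivative_add [OF has_derivative_const [of x0] bounded_linear.has_derivative
        [OF P has_derivative_diff [OF has_derivative_ident has_derivative_const [of x0]]]]
    by simp
  have "((\<lambda>y. h (x0 + ?P (y - x0))) has_derivative (\<lambda>v. ?P v \<bullet> D)) (at x0)"
    using has_derivative_compose [OF inner, of h "\<lambda>v. v \<bullet> D"] h 0
    by (simp add: gderiv_def)
  then show "GDERIV (restrict_to_subspace U x0 h) x0 :> ?P D"
    by (simp add: gderiv_def restrict_to_subspace_def [abs_def] orth_projection_self_adjoint [OF U])
qed

section \<open>Error of a centred difference\<close>

text \<open>
  Integrating \<open>u'' t \<le> M t\<close> twice. In place of integrals, the comparison functions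
  \<open>M t\<^sup>2 / 2 - u' t\<close> and \<open>M t\<^sup>3 / 6 - u t\<close> are seen to be nondecreasing.
\<close>

lemma le_of_second_derivative_le_linear:
  fixes u u' u'' :: "real \<Rightarrow> real"
  assumes u: "\<And>t. 0 \<le> t \<Longrightarrow> t \<le> 1 \<Longrightarrow> (u has_real_derivative u' t) (at t)"
    and u': "\<And>t. 0 \<le> t \<Longrightarrow> t \<le> 1 \<Longrightarrow> (u' has_real_derivative u'' t) (at t)"
    and u'': "\<And>t. 0 \<le> t \<Longrightarrow> t \<le> 1 \<Longrightarrow> u'' t \<le> M * t"
    and "u 0 = 0" "u' 0 = 0"
  shows "u 1 \<le> M / 6"
proof -
  have u'_le: "u' t \<le> M * t\<^sup>2 / 2" if t: "0 \<le> t" "t \<le> 1" for t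
  proof -
    have "M * 0\<^sup>2 / 2 - u' 0 \<le> M * t\<^sup>2 / 2 - u' t"
    proof (rule DERIV_nonneg_imp_nondecreasing [OF t(1), where f = "\<lambda>s. M * s\<^sup>2 / 2 - u' s"])
      fix s :: real assume s: "0 \<le> s" "s \<le> t"
      have "((\<lambda>s. M * s\<^sup>2 / 2 - u' s) has_real_derivative M * s - u'' s) (at s)"
        using s t by (auto intro!: derivative_eq_intros u')
      then show "\<exists>y. ((\<lambda>s. M * s\<^sup>2 / 2 - u' s) has_real_derivative y) (at s) \<and> 0 \<le> y"
        using u'' [of s] s t by auto
    qed
    then show ?thesis
      using \<open>u' 0 = 0\<close> by simp
  qed
  have "M * 0 ^ 3 / 6 - u 0 \<le> M * 1 ^ 3 / 6 - u 1"
  proof (rule DERIV_nonneg_imp_nondecreasing [where f = "\<lambda>s. M * s ^ 3 / 6 - u s"])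
    fix s :: real assume s: "0 \<le> s" "s \<le> 1"
    have "((\<lambda>s. M * s ^ 3 / 6 - u s) has_real_derivative M * s\<^sup>2 / 2 - u' s) (at s)"
      using s by (auto intro!: derivative_eq_intros u)
    then show "\<exists>y. ((\<lambda>s. M * s ^ 3 / 6 - u s) has_real_derivative y) (at s) \<and> 0 \<le> y"
      using u'_le [of s] s by auto
  qed simp
  then show ?thesis
    using \<open>u 0 = 0\<close> by simp
qed

text \<open>
  The odd part of \<open>\<phi>\<close>, with its linear term removed, has the second derivative
  \<open>(\<phi>'' t - \<phi>'' (- t)) / 2\<close>. The value \<open>\<phi>'' 0\<close> has cancelled, so a bound on the
  variation of \<open>\<phi>''\<close> between opposite points makes it grow at most linearly.
\<close>

lemma centred_difference_error_real:
  fixes \<phi> \<phi>' \<phi>'' :: "real \<Rightarrow> real"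
  assumes \<phi>: "\<And>t. \<bar>t\<bar> \<le> 1 \<Longrightarrow> (\<phi> has_real_derivative \<phi>' t) (at t)"
    and \<phi>': "\<And>t. \<bar>t\<bar> \<le> 1 \<Longrightarrow> (\<phi>' has_real_derivative \<phi>'' t) (at t)"
    and \<phi>'': "\<And>t. 0 \<le> t \<Longrightarrow> t \<le> 1 \<Longrightarrow> \<bar>\<phi>'' t - \<phi>'' (- t)\<bar> \<le> 2 * M * t"
  shows "\<bar>(\<phi> 1 - \<phi> (- 1)) / 2 - \<phi>' 0\<bar> \<le> M / 6"
proof -
  define u where "u t = (\<phi> t - \<phi> (- t)) / 2 - t * \<phi>' 0" for t
  define u' where "u' t = (\<phi>' t + \<phi>' (- t)) / 2 - \<phi>' 0" for t
  define u'' where "u'' t = (\<phi>'' t - \<phi>'' (- t)) / 2" for t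
  have u: "(u has_real_derivative u' t) (at t)" if t: "0 \<le> t" "t \<le> 1" for t
  proof -
    have "((\<lambda>t. \<phi> (- t)) has_real_derivative - \<phi>' (- t)) (at t)"
      using DERIV_chain2 [OF \<phi> DERIV_minus [OF DERIV_ident], of t UNIV] t
      by simp
    with t show ?thesis
      unfolding u_def [abs_def] u'_def
      by (auto intro!: derivative_eq_intros \<phi>)
  qed
  have u': "(u' has_real_derivative u'' t) (at t)" if t: "0 \<le> t" "t \<le> 1" for t
  proof -
    have "((\<lambda>t. \<phi>' (- t)) has_real_derivative - \<phi>'' (- t)) (at t)"
      using DERIV_chain2 [OF \<phi>' DERIV_minus [OF DERIV_ident], of t UNIV] t
      by simp
    with t show ?thesis
      unfolding u'_def [abs_def] u''_def
      by (auto intro!: derivative_eq_intros \<phi>')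
  qed
  have bound: "\<bar>u'' t\<bar> \<le> M * t" if "0 \<le> t" "t \<le> 1" for t
    using \<phi>'' [OF that] by (simp add: u''_def)
  have "u 1 \<le> M / 6"
    by (rule le_of_second_derivative_le_linear [OF u u'])
       (use bound in \<open>auto simp: u_def u'_def abs_le_iff\<close>)
  moreover have "- u 1 \<le> M / 6"
    by (rule le_of_second_derivative_le_linear [of "\<lambda>t. - u t" "\<lambda>t. - u' t" "\<lambda>t. - u'' t"])
       (use bound in \<open>auto simp: abs_le_iff intro!: DERIV_minus u u', simp_all add: u_def u'_def\<close>)
  ultimately show ?thesis
    unfolding u_def by (intro abs_leI) simp_all
qed

text \<open>
  The one-dimensional estimate along the segment from \<open>x0 - d\<close> to \<open>x0 + d\<close>. The points with
  parameters \<open>t\<close> and \<open>- t\<close> are \<open>2 t \<parallel>d\<parallel>\<close> apart, and the quadratic form of the Hessian contributes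
  two further factors \<open>\<parallel>d\<parallel>\<close>, so that \<open>M = L \<parallel>d\<parallel>\<^sup>3\<close>.
\<close>

lemma centred_difference_error:
  fixes h :: "real^'n \<Rightarrow> real"
  assumes h: "Ck_on (Suc (Suc k)) h (ball x0 r)"
    and L: "\<And>y z. y \<in> ball x0 r \<Longrightarrow> z \<in> ball x0 r \<Longrightarrow>
              op_norm (hessian h y - hessian h z) \<le> L * norm (y - z)"
    and d: "norm d < r"
  shows "\<bar>(h (x0 + d) - h (x0 - d)) / 2 - d \<bullet> gradient h x0\<bar> \<le> L * norm d ^ 3 / 6"
proof -
  have mem: "x0 + t *\<^sub>R d \<in> ball x0 r" if "\<bar>t\<bar> \<le> 1" for t
  proof -
    have "\<bar>t\<bar> * norm d \<le> norm d"
      using that by (simp add: mult_left_le_one_le)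
    then show ?thesis
      using d by (simp add: dist_norm)
  qed
  have line: "((\<lambda>t. x0 + t *\<^sub>R d) has_derivative (\<lambda>s. s *\<^sub>R d)) (at t)" for t
    by (auto intro!: derivative_eq_intros)
  have "\<bar>(h (x0 + 1 *\<^sub>R d) - h (x0 + (- 1) *\<^sub>R d)) / 2 - d \<bullet> gradient h (x0 + 0 *\<^sub>R d)\<bar>
      \<le> (L * norm d ^ 3) / 6"
  proof (rule centred_difference_error_real
      [where \<phi>'' = "\<lambda>t. d \<bullet> (hessian h (x0 + t *\<^sub>R d) *v d)"])
    fix t :: real assume t: "\<bar>t\<bar> \<le> 1"
    have "((\<lambda>t. h (x0 + t *\<^sub>R d)) has_derivative (\<lambda>s. (s *\<^sub>R d) \<bullet> gradient h (x0 + t *\<^sub>R d))) (at t)"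
      using has_derivative_compose [OF line GDERIV_gradient_if_Ck_on [OF h mem [OF t], unfolded gderiv_def]] .
    then show "((\<lambda>t. h (x0 + t *\<^sub>R d)) has_real_derivative d \<bullet> gradient h (x0 + t *\<^sub>R d)) (at t)"
      unfolding has_field_derivative_def
      by (rule has_derivative_eq_rhs) (simp add: fun_eq_iff mult.commute)
    have "((\<lambda>t. gradient h (x0 + t *\<^sub>R d)) has_derivative
        (\<lambda>s. hessian h (x0 + t *\<^sub>R d) *v (s *\<^sub>R d))) (at t)"
      using has_derivative_compose [OF line gradient_has_derivative_hessian [OF h open_ball mem [OF t]]] .
    then have "((\<lambda>t. d \<bullet> gradient h (x0 + t *\<^sub>R d)) has_derivative
        (\<lambda>s. d \<bullet> (hessian h (x0 + t *\<^sub>R d) *v (s *\<^sub>R d)))) (at t)"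
      by (rule has_derivative_inner_right)
    then show "((\<lambda>t. d \<bullet> gradient h (x0 + t *\<^sub>R d)) has_real_derivative
        d \<bullet> (hessian h (x0 + t *\<^sub>R d) *v d)) (at t)"
      unfolding has_field_derivative_def
      by (rule has_derivative_eq_rhs) (simp add: fun_eq_iff matrix_vector_mult_scaleR mult.commute)
  next
    fix t :: real assume t: "0 \<le> t" "t \<le> 1"
    let ?H = "hessian h (x0 + t *\<^sub>R d) - hessian h (x0 + (- t) *\<^sub>R d)"
    have "\<bar>d \<bullet> (?H *v d)\<bar> \<le> norm d * (op_norm ?H * norm d)"
      by (rule order_trans [OF Cauchy_Schwarz_ineq2])
        (intro mult_left_mono norm_matrix_vector_mult_le norm_ge_zero)
    also have "\<dots> \<le> norm d * ((L * norm (x0 + t *\<^sub>R d - (x0 + (- t) *\<^sub>R d))) * norm d)"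
      using t by (intro mult_left_mono mult_right_mono L mem) auto
    also have "x0 + t *\<^sub>R d - (x0 + (- t) *\<^sub>R d) = (2 * t) *\<^sub>R d"
      by (simp add: vec_eq_iff algebra_simps)
    also have "norm d * ((L * norm ((2 * t) *\<^sub>R d)) * norm d) = 2 * (L * norm d ^ 3) * t"
      using t by (simp add: power3_eq_cube)
    finally show "\<bar>d \<bullet> (hessian h (x0 + t *\<^sub>R d) *v d) - d \<bullet> (hessian h (x0 + (- t) *\<^sub>R d) *v d)\<bar>
        \<le> 2 * (L * norm d ^ 3) * t"
      by (simp add: matrix_vector_mult_diff_rdistrib inner_diff_right)
  qed
  then show ?thesis
    by simp
qed

section \<open>Error of the centred simplex gradients\<close>

text \<open>
  Replacing \<open>\<parallel>d\<^sup>i\<parallel>\<close> by the radius in the error bounds requires \<open>L \<ge> 0\<close>. A bound that holds at two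
  distinct points of the ball forces this sign.
\<close>

lemma lipschitz_constant_nonneg:
  fixes F :: "real^'n \<Rightarrow> real^'p^'q" and x0 d :: "real^'n"
  assumes L: "\<And>y z. y \<in> ball x0 r \<Longrightarrow> z \<in> ball x0 r \<Longrightarrow> op_norm (F y - F z) \<le> L * norm (y - z)"
    and d: "norm d < r" "d \<noteq> 0"
  shows "0 \<le> L"
proof -
  have r: "0 < r"
    using norm_ge_zero d(1) by (rule le_less_trans)
  have "0 \<le> L * norm (x0 + d - x0)"
    by (rule order_trans [OF op_norm_nonneg L]) (use d r in \<open>auto simp: dist_norm\<close>)
  then show ?thesis
    using d(2) by (simp add: zero_le_mult_iff)
qed

lemma norm_le_radius: "norm (x i - x0) \<le> radius x0 x"
  unfolding radius_def by (rule Max_ge) auto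

text \<open>
  By the projection property of \<open>B S\<^sup>T\<close>, the error is \<open>B\<close> applied to the vector of centred
  difference errors, so it is enough to bound the entries of that vector.
\<close>

lemma simplex_gradient_error:
  fixes h :: "real^'n \<Rightarrow> real" and x :: "'m::finite \<Rightarrow> real^'n"
  assumes h: "Ck_on (Suc (Suc k)) h (ball x0 r)"
    and L: "\<And>y z. y \<in> ball x0 r \<Longrightarrow> z \<in> ball x0 r \<Longrightarrow>
              op_norm (hessian h y - hessian h z) \<le> L * norm (y - z)"
    and L0: "0 \<le> L"
    and r: "radius x0 x < r"
  shows "norm (centred_simplex_gradient h x0 x
               - orth_projection (span (columns (simplex_matrix x0 x))) (gradient h x0))
         \<le> sqrt (real CARD('m)) / 6 * L * op_norm (pseudoinverse (transpose (simplex_matrix x0 x)))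
             * radius x0 x ^ 3"
proof -
  let ?A = "transpose (simplex_matrix x0 x)"
  let ?B = "pseudoinverse ?A"
  let ?e = "centred_difference h x0 x - ?A *v gradient h x0"
  have "\<bar>?e $ i\<bar> \<le> L * radius x0 x ^ 3 / 6" for i
  proof -
    have "(?A *v gradient h x0) $ i = (x i - x0) \<bullet> gradient h x0"
      by (simp add: matrix_vector_mult_def transpose_def simplex_matrix_def inner_vec_def)
    then have "\<bar>?e $ i\<bar> \<le> L * norm (x i - x0) ^ 3 / 6"
      using centred_difference_error [OF h L, of "x i - x0"] norm_le_radius [of x i x0] r
      by (simp add: centred_difference_def)
    also have "\<dots> \<le> L * radius x0 x ^ 3 / 6"
      using L0 by (intro divide_right_mono mult_left_mono power_mono norm_le_radius) auto
    finally show ?thesis .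
  qed
  then have e: "norm ?e \<le> sqrt (real CARD('m)) * (L * radius x0 x ^ 3 / 6)"
    by (rule norm_vec_le_sqrt_card)
  have "norm (centred_simplex_gradient h x0 x
               - orth_projection (span (columns (simplex_matrix x0 x))) (gradient h x0))
      = norm (?B *v ?e)"
    by (simp add: centred_simplex_gradient_def matrix_vector_mult_diff_distrib
        flip: pseudoinverse_transpose_mult_eq_orth_projection)
  also have "\<dots> \<le> op_norm ?B * norm ?e"
    by (rule norm_matrix_vector_mult_le)
  also have "\<dots> \<le> op_norm ?B * (sqrt (real CARD('m)) * (L * radius x0 x ^ 3 / 6))"
    by (intro mult_left_mono e op_norm_nonneg)
  finally show ?thesis
    by (simp add: algebra_simps)
qed

theorem proposition5p2:
  fixes f g :: "real^'n \<Rightarrow> real"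
    and x0 :: "real^'n" and x :: "'m::finite \<Rightarrow> real^'n"
    and S :: "real^'m^'n" and U :: "(real^'n) set"
    and \<Delta> \<Delta>bar Lf Lg :: real
  assumes f_C3: "Ck_on 3 f (ball x0 \<Delta>bar)"
    and g_C3: "Ck_on 3 g (ball x0 \<Delta>bar)"
    and Lf: "\<And>y z. y \<in> ball x0 \<Delta>bar \<Longrightarrow> z \<in> ball x0 \<Delta>bar \<Longrightarrow>
               op_norm (hessian f y - hessian f z) \<le> Lf * norm (y - z)"
    and Lg: "\<And>y z. y \<in> ball x0 \<Delta>bar \<Longrightarrow> z \<in> ball x0 \<Delta>bar \<Longrightarrow>
               op_norm (hessian g y - hessian g z) \<le> Lg * norm (y - z)"
    and distinct: "inj x" "x0 \<notin> range x"
    and \<Delta>_def: "\<Delta> = radius x0 x"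
    and \<Delta>_less: "\<Delta> < \<Delta>bar"
    and S_def: "S = simplex_matrix x0 x"
    and full_rank: "rank S = min CARD('m) CARD('n)"
    and U_def: "U = span (columns S)"
  shows "norm (centred_simplex_calculus_gradient f g x0 x
               - gradient (restrict_to_subspace U x0 (\<lambda>y. f y * g y)) x0)
         \<le> sqrt (real CARD('m)) / 6 * (Lg * \<bar>f x0\<bar> + Lf * \<bar>g x0\<bar>)
             * op_norm (pseudoinverse (transpose ((1 / \<Delta>) *\<^sub>R S))) * \<Delta>\<^sup>2"
proof -
  let ?r = "radius x0 x"
  let ?b = "op_norm (pseudoinverse (transpose S))"
  let ?P = "orth_projection U"
  let ?Gf = "centred_simplex_gradient f x0 x" and ?Gg = "centred_simplex_gradient g x0 x"
  \<comment> \<open>A type is nonempty, so there is at least one direction. It is nonzero, which makes the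
    radius positive and the two Lipschitz constants nonnegative.\<close>
  obtain i :: 'm where True by blast
  have d: "norm (x i - x0) < \<Delta>bar" "x i - x0 \<noteq> 0"
    using norm_le_radius [of x i x0] \<Delta>_less \<Delta>_def distinct(2) by auto
  then have "0 < \<Delta>"
    unfolding \<Delta>_def using norm_le_radius [of x i x0] less_le_trans by (metis zero_less_norm_iff)
  have f: "Ck_on (Suc (Suc 1)) f (ball x0 \<Delta>bar)" and g: "Ck_on (Suc (Suc 1)) g (ball x0 \<Delta>bar)"
    using f_C3 g_C3 by (simp_all add: numeral_3_eq_3)
  have x0: "x0 \<in> ball x0 \<Delta>bar"
    using \<open>0 < \<Delta>\<close> \<Delta>_less by simp
  note r = \<Delta>_less [unfolded \<Delta>_def]
  have ef: "norm (?Gf - ?P (gradient f x0)) \<le> sqrt (real CARD('m)) / 6 * Lf * ?b * \<Delta> ^ 3"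
    using simplex_gradient_error [OF f Lf lipschitz_constant_nonneg [OF Lf d] r]
    by (simp add: S_def U_def \<Delta>_def)
  have eg: "norm (?Gg - ?P (gradient g x0)) \<le> sqrt (real CARD('m)) / 6 * Lg * ?b * \<Delta> ^ 3"
    using simplex_gradient_error [OF g Lg lipschitz_constant_nonneg [OF Lg d] r]
    by (simp add: S_def U_def \<Delta>_def)
  have U: "subspace U"
    by (simp add: U_def)
  have grad: "gradient (restrict_to_subspace U x0 (\<lambda>y. f y * g y)) x0
      = f x0 *\<^sub>R ?P (gradient g x0) + g x0 *\<^sub>R ?P (gradient f x0)"
    using gradient_restrict_to_subspace
      [OF U GDERIV_mult [OF GDERIV_gradient_if_Ck_on [OF f x0] GDERIV_gradient_if_Ck_on [OF g x0]]]
    by (simp add: linear_add [OF linear_orth_projection [OF U]]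
        linear_cmul [OF linear_orth_projection [OF U]])
  have "transpose ((1 / \<Delta>) *\<^sub>R S) = (1 / \<Delta>) *\<^sub>R transpose S"
    by (simp add: transpose_scalar)
  then have scaled: "op_norm (pseudoinverse (transpose ((1 / \<Delta>) *\<^sub>R S))) = \<Delta> * ?b"
    using \<open>0 < \<Delta>\<close> by (simp add: pseudoinverse_scaleR op_norm_scaleR)
  have "norm (centred_simplex_calculus_gradient f g x0 x
               - gradient (restrict_to_subspace U x0 (\<lambda>y. f y * g y)) x0)
      = norm (f x0 *\<^sub>R (?Gg - ?P (gradient g x0)) + g x0 *\<^sub>R (?Gf - ?P (gradient f x0)))"
    by (simp add: grad centred_simplex_calculus_gradient_def algebra_simps)
  also have "\<dots> \<le> \<bar>f x0\<bar> * norm (?Gg - ?P (gradient g x0)) + \<bar>g x0\<bar> * norm (?Gf - ?P (gradient f x0))"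
    by (rule norm_triangle_le) simp
  also have "\<dots> \<le> \<bar>f x0\<bar> * (sqrt (real CARD('m)) / 6 * Lg * ?b * \<Delta> ^ 3)
      + \<bar>g x0\<bar> * (sqrt (real CARD('m)) / 6 * Lf * ?b * \<Delta> ^ 3)"
    by (intro add_mono mult_left_mono ef eg) auto
  also have "\<dots> = sqrt (real CARD('m)) / 6 * (Lg * \<bar>f x0\<bar> + Lf * \<bar>g x0\<bar>) * (\<Delta> * ?b) * \<Delta>\<^sup>2"
    by (simp add: algebra_simps power2_eq_square power3_eq_cube)
  finally show ?thesis
    by (simp only: scaled)
qed

end
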